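(* Let $u,v\in S_n$, $\mathbf{a}\in[n]^n$, and $i\in[n-1]$. If $u\lesssim_{\mathbf{a}}v$ and $i\in\mathrm{Des}_{\mathbf{a}}(v)\cap\mathrm{Asc}_{\mathbf{a}}(u)$, then $us_i\lesssim_{\mathbf{a}}v$ and $u\lesssim_{\mathbf{a}}vs_i$.
   Context: Permutations are in one-line notation $w=w_1\cdots w_n$, $w[k]:=\{w_1,\dots,w_k\}$; $ws_i$ is obtained from $w$ by swapping the entries in positions $i$ and $i+1$. Cyclic interval $[a,b)_c$: $\{a,\dots,b-1\}$ if $a\le b$, $\{a,\dots,n\}\cup\{1,\dots,b-1\}$ if $a>b$. For $r\in[n]$, $<_r$ is the total order $r<_r r+1<_r\cdots<_r n<_r 1<_r\cdots<_r r-1$ on $[n]$; for $k$-subsets $A=\{a_1<_r\cdots<_r a_k\}$, $B=\{b_1<_r\cdots<_r b_k\}$, $A\le_r B$ means $a_i\le_r b_i$ for all $i$. For $\mathbf{a}=(a_1,\dots,a_n)\in[n]^n$: $u\lesssim_{\mathbf{a}}v$ iff $u[k]\le_{a_k}v[k]$ for all $k\in[n]$ and $|u[k]\cap[a_k,a_{k+1})_c|=|v[k]\cap[a_k,a_{k+1})_c|$ for all $k\in[n-1]$. The $\mathbf{a}$-descent and $\mathbf{a}$-ascent sets are $\mathrm{Des}_{\mathbf{a}}(w):=\{i\in[n-1]:a_i=a_{i+1},\ w_i>_{a_i}w_{i+1}\}$ and $\mathrm{Asc}_{\mathbf{a}}(w):=\{i\in[n-1]:a_i=a_{i+1},\ w_i<_{a_i}w_{i+1}\}$.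 *)

theory Defs
  imports "HOL-Combinatorics.Permutations" "HOL-Library.FuncSet"
begin

text \<open>
  A permutation of \<open>[n] = {1..n}\<close> is a function \<open>w\<close> with \<open>w permutes {1..n}\<close>; the entry in
  position \<open>k\<close> of its one-line notation is \<open>w k\<close>. A sequence in \<open>[n]^n\<close> is a function
  \<open>a \<in> {1..n} \<rightarrow> {1..n}\<close>, whose values outside \<open>{1..n}\<close> are never used.
\<close>

definition prefix_set :: "(nat \<Rightarrow> nat) \<Rightarrow> nat \<Rightarrow> nat set" where
  "prefix_set w k = w ` {1..k}"

definition swap_right :: "(nat \<Rightarrow> nat) \<Rightarrow> nat \<Rightarrow> (nat \<Rightarrow> nat)" where
  "swap_right w i = w \<circ> Transposition.transpose i (i + 1)"

definition cyc_interval :: "nat \<Rightarrow> nat \<Rightarrow> nat \<Rightarrow> nat set" where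
  "cyc_interval n a b = (if a \<le> b then {a..<b} else {a..n} \<union> {1..<b})"

text \<open>
  The zero-based position of \<open>x\<close> in the list \<open>r, r + 1, \<dots>, n, 1, \<dots>, r - 1\<close>
  (for \<open>r\<close> and \<open>x\<close> in \<open>{1..n}\<close>).
\<close>

definition cyc_pos :: "nat \<Rightarrow> nat \<Rightarrow> nat \<Rightarrow> nat" where
  "cyc_pos n r x = (if r \<le> x then x - r else x + n - r)"

definition cyc_less :: "nat \<Rightarrow> nat \<Rightarrow> nat \<Rightarrow> nat \<Rightarrow> bool" where
  "cyc_less n r x y \<longleftrightarrow> cyc_pos n r x < cyc_pos n r y"

definition cyc_le :: "nat \<Rightarrow> nat \<Rightarrow> nat \<Rightarrow> nat \<Rightarrow> bool" where
  "cyc_le n r x y \<longleftrightarrow> x = y \<or> cyc_less n r x y"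

text \<open>
  \<open>xs\<close> and \<open>ys\<close> are the increasing enumerations \<open>a_1 <_r \<dots> <_r a_k\<close> of \<open>A\<close> and
  \<open>b_1 <_r \<dots> <_r b_k\<close> of \<open>B\<close>; for subsets of \<open>{1..n}\<close> they exist and are unique.
  \<open>list_all2\<close> demands equal lengths, so \<open>A\<close> and \<open>B\<close> have the same cardinality.
\<close>

definition gale_le :: "nat \<Rightarrow> nat \<Rightarrow> nat set \<Rightarrow> nat set \<Rightarrow> bool" where
  "gale_le n r A B \<longleftrightarrow>
     (\<exists>xs ys. sorted_wrt (cyc_less n r) xs \<and> set xs = A \<and>
              sorted_wrt (cyc_less n r) ys \<and> set ys = B \<and>
              list_all2 (cyc_le n r) xs ys)"

definition tilted_le ::
    "nat \<Rightarrow> (nat \<Rightarrow> nat) \<Rightarrow> (nat \<Rightarrow> nat) \<Rightarrow> (nat \<Rightarrow> nat) \<Rightarrow> bool" where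
  "tilted_le n a u v \<longleftrightarrow>
     (\<forall>k\<in>{1..n}. gale_le n (a k) (prefix_set u k) (prefix_set v k)) \<and>
     (\<forall>k\<in>{1..<n}.
        card (prefix_set u k \<inter> cyc_interval n (a k) (a (k + 1))) =
        card (prefix_set v k \<inter> cyc_interval n (a k) (a (k + 1))))"

definition Des :: "nat \<Rightarrow> (nat \<Rightarrow> nat) \<Rightarrow> (nat \<Rightarrow> nat) \<Rightarrow> nat set" where
  "Des n a w = {i \<in> {1..<n}. a i = a (i + 1) \<and> cyc_less n (a i) (w (i + 1)) (w i)}"

definition Asc :: "nat \<Rightarrow> (nat \<Rightarrow> nat) \<Rightarrow> (nat \<Rightarrow> nat) \<Rightarrow> nat set" where
  "Asc n a w = {i \<in> {1..<n}. a i = a (i + 1) \<and> cyc_less n (a i) (w i) (w (i + 1))}"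

end

theory Submission
  imports Defs
begin

text \<open>
  The order \<open>\<le>\<^sub>r\<close> on sets of equal size is a comparison of rank functions: how many elements lie
  among the first \<open>m\<close> elements of \<open><\<^sub>r\<close>. Equal cardinalities on \<open>[a\<^sub>k, a\<^sub>k\<^sub>+\<^sub>1)\<^sub>c\<close> allow
  \<open>\<le>\<close> with respect to \<open>a\<^sub>k\<close> to be replaced by \<open>\<le>\<close> with respect to \<open>a\<^sub>k\<^sub>+\<^sub>1\<close>. Hence the
  prefixes of lengths \<open>i - 1\<close>, \<open>i\<close>, \<open>i + 1\<close> are all comparable for the single order given by
  \<open>a\<^sub>i = a\<^sub>i\<^sub>+\<^sub>1\<close>, and the argument of the lifting property of the ordinary Bruhat order applies:
  only the prefix of length \<open>i\<close> changes, and its rank function is controlled by the two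
  neighbouring ones.
\<close>

section \<open>Rank functions and the order on subsets\<close>

definition rank_count :: "nat \<Rightarrow> nat \<Rightarrow> nat set \<Rightarrow> nat \<Rightarrow> nat" where
  "rank_count n r A m = card {x \<in> A. cyc_pos n r x < m}"

lemma cyc_pos_inj_on: "r \<in> {1..n} \<Longrightarrow> inj_on (cyc_pos n r) {1..n}"
  by (rule inj_onI) (auto simp: cyc_pos_def split: if_splits)

lemma cyc_pos_less: "r \<in> {1..n} \<Longrightarrow> x \<in> {1..n} \<Longrightarrow> cyc_pos n r x < n"
  by (auto simp: cyc_pos_def)

text \<open>Injectivity of positions on \<open>{1..n}\<close> absorbs the equality disjunct of
  \<open>cyc_le\<close>.\<close>

lemma cyc_le_iff:
  assumes "r \<in> {1..n}" "x \<in> {1..n}" "y \<in> {1..n}"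
  shows "cyc_le n r x y \<longleftrightarrow> cyc_pos n r x \<le> cyc_pos n r y"
  using inj_on_eq_iff[OF cyc_pos_inj_on[OF assms(1)] assms(2,3)]
  by (auto simp: cyc_le_def cyc_less_def)

lemma sorted_wrt_cyc_less_iff:
  "sorted_wrt (cyc_less n r) xs \<longleftrightarrow> sorted_wrt (<) (map (cyc_pos n r) xs)"
  by (simp add: sorted_wrt_map cyc_less_def[abs_def])

lemma sorted_wrt_cyc_less_distinct: "sorted_wrt (cyc_less n r) xs \<Longrightarrow> distinct xs"
  unfolding sorted_wrt_cyc_less_iff strict_sorted_iff by (simp add: distinct_map)

lemma rank_count_sorted:
  assumes "sorted_wrt (cyc_less n r) xs"
  shows "rank_count n r (set xs) m = length (filter (\<lambda>x. cyc_pos n r x < m) xs)"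
  using distinct_card[OF distinct_filter[OF sorted_wrt_cyc_less_distinct[OF assms]],
      of "\<lambda>x. cyc_pos n r x < m"]
  by (simp add: rank_count_def)

lemma ex_sorted_wrt_cyc_less:
  assumes "r \<in> {1..n}" "A \<subseteq> {1..n}"
  obtains xs where "sorted_wrt (cyc_less n r) xs" "set xs = A"
proof
  let ?xs = "sort_key (cyc_pos n r) (sorted_list_of_set A)"
  have fin: "finite A" using assms(2) finite_subset by blast
  show "set ?xs = A" using fin by simp
  have "inj_on (cyc_pos n r) A" using cyc_pos_inj_on[OF assms(1)] assms(2) inj_on_subset by blast
  then show "sorted_wrt (cyc_less n r) ?xs"
    using fin unfolding sorted_wrt_cyc_less_iff strict_sorted_iff by (simp add: distinct_map)
qed

text \<open>If the j-th elements satisfy \<open>cyc_le\<close>, every element of \<open>B\<close>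
  counted below a threshold has its partner in \<open>A\<close> counted too. Conversely, a first
  enumeration exceeding the second at some index makes the rank of \<open>B\<close> exceed that of
  \<open>A\<close> just past the offending element of \<open>B\<close>.\<close>

lemma gale_le_iff_rank_count:
  assumes r: "r \<in> {1..n}" and A: "A \<subseteq> {1..n}" and B: "B \<subseteq> {1..n}"
  shows "gale_le n r A B \<longleftrightarrow>
    card A = card B \<and> (\<forall>m. rank_count n r B m \<le> rank_count n r A m)"
proof (intro iffI)
  assume "gale_le n r A B"
  then obtain xs ys where xs: "sorted_wrt (cyc_less n r) xs" "set xs = A"
    and ys: "sorted_wrt (cyc_less n r) ys" "set ys = B"
    and le: "list_all2 (cyc_le n r) xs ys"
    unfolding gale_le_def by blast
  have "length (filter (\<lambda>x. cyc_pos n r x < m) ys) \<le> length (filter (\<lambda>x. cyc_pos n r x < m) xs)"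
    for m
    using le by induction (auto simp: cyc_le_def cyc_less_def)
  then have "rank_count n r B m \<le> rank_count n r A m" for m
    using rank_count_sorted[OF xs(1)] rank_count_sorted[OF ys(1)] xs(2) ys(2) by simp
  moreover have "card A = card B"
    using le distinct_card[OF sorted_wrt_cyc_less_distinct[OF xs(1)]]
      distinct_card[OF sorted_wrt_cyc_less_distinct[OF ys(1)]] xs(2) ys(2)
    by (simp add: list_all2_lengthD)
  ultimately show "card A = card B \<and> (\<forall>m. rank_count n r B m \<le> rank_count n r A m)" by blast
next
  assume *: "card A = card B \<and> (\<forall>m. rank_count n r B m \<le> rank_count n r A m)"
  obtain xs where xs: "sorted_wrt (cyc_less n r) xs" "set xs = A"
    using ex_sorted_wrt_cyc_less[OF r A] .
  obtain ys where ys: "sorted_wrt (cyc_less n r) ys" "set ys = B"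
    using ex_sorted_wrt_cyc_less[OF r B] .
  note dxs = sorted_wrt_cyc_less_distinct[OF xs(1)]
  note dys = sorted_wrt_cyc_less_distinct[OF ys(1)]
  have len: "length xs = length ys" using * distinct_card[OF dxs] distinct_card[OF dys] xs(2) ys(2) by simp
  have "cyc_pos n r (xs ! j) \<le> cyc_pos n r (ys ! j)" if j: "j < length xs" for j
  proof (rule ccontr)
    assume "\<not> ?thesis"
    then have gt: "cyc_pos n r (ys ! j) < cyc_pos n r (xs ! j)" by simp
    \<comment> \<open>The successor makes the strict threshold include \<open>ys ! j\<close> itself.
      As indices start at 0, at least \<open>Suc j\<close> elements of \<open>B\<close> lie below
      \<open>?m\<close>, while only the \<open>j\<close> entries of \<open>xs\<close> before
      \<open>xs ! j\<close> can.\<close>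
    let ?m = "Suc (cyc_pos n r (ys ! j))"
    have mono: "cyc_pos n r (zs ! p) < cyc_pos n r (zs ! q)"
      if "sorted_wrt (cyc_less n r) zs" "p < q" "q < length zs" for zs p q
      using sorted_wrt_nth_less[OF that] by (simp add: cyc_less_def)
    have "{x \<in> A. cyc_pos n r x < ?m} \<subseteq> set (take j xs)"
    proof
      fix x assume "x \<in> {x \<in> A. cyc_pos n r x < ?m}"
      then obtain p where p: "p < length xs" "x = xs ! p"
        and lt: "cyc_pos n r (xs ! p) < cyc_pos n r (xs ! j)"
        using xs(2) gt by (auto simp: in_set_conv_nth)
      have "p < j" using mono[OF xs(1), of j p] p(1) lt by (cases p j rule: linorder_cases) auto
      with p j have "x = take j xs ! p" "p < length (take j xs)" by auto
      then show "x \<in> set (take j xs)" using nth_mem by blast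
    qed
    then have "rank_count n r A ?m \<le> card (set (take j xs))"
      unfolding rank_count_def by (intro card_mono) auto
    also have "\<dots> = j" using dxs j by (simp add: distinct_card)
    finally have 1: "rank_count n r A ?m \<le> j" .
    have "set (take (Suc j) ys) \<subseteq> {x \<in> B. cyc_pos n r x < ?m}"
    proof
      fix x assume "x \<in> set (take (Suc j) ys)"
      then obtain p where p: "p \<le> j" "x = ys ! p"
        by (auto simp: in_set_conv_nth less_Suc_eq_le)
      have "cyc_pos n r (ys ! p) \<le> cyc_pos n r (ys ! j)"
        using mono[OF ys(1), of p j] p(1) j len by (cases "p = j") auto
      with p j len ys(2) show "x \<in> {x \<in> B. cyc_pos n r x < ?m}" by auto
    qed
    moreover have "finite B" using B finite_subset by blast
    ultimately have "card (set (take (Suc j) ys)) \<le> rank_count n r B ?m"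
      unfolding rank_count_def by (intro card_mono) auto
    moreover have "card (set (take (Suc j) ys)) = Suc j" using dys j len by (simp add: distinct_card)
    ultimately have "Suc j \<le> rank_count n r B ?m" by simp
    moreover have "rank_count n r B ?m \<le> rank_count n r A ?m" using * by blast
    ultimately show False using 1 by linarith
  qed
  moreover have "xs ! j \<in> {1..n}" "ys ! j \<in> {1..n}" if "j < length xs" for j
    using that len xs(2) ys(2) A B nth_mem[of j xs] nth_mem[of j ys] by auto
  ultimately have "list_all2 (cyc_le n r) xs ys"
    unfolding list_all2_conv_all_nth using len cyc_le_iff[OF r] by simp
  then show "gale_le n r A B"
    unfolding gale_le_def by (intro exI[of _ xs] exI[of _ ys]) (simp add: xs ys)
qed

section \<open>Changing the starting point of the cyclic order\<close>

lemma cyc_interval_iff: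
  assumes "r \<in> {1..n}" "s \<in> {1..n}" "x \<in> {1..n}"
  shows "x \<in> cyc_interval n r s \<longleftrightarrow> cyc_pos n r x < cyc_pos n r s"
  using assms by (auto simp: cyc_interval_def cyc_pos_def)

text \<open>The cyclic interval is the initial segment of the order starting at \<open>r\<close>
  that ends just before \<open>s\<close>, so the cardinality condition in \<open>tilted_le\<close>
  fixes one value of a rank function.\<close>

lemma card_Int_cyc_interval:
  assumes "r \<in> {1..n}" "s \<in> {1..n}" "A \<subseteq> {1..n}"
  shows "card (A \<inter> cyc_interval n r s) = rank_count n r A (cyc_pos n r s)"
proof -
  have "A \<inter> cyc_interval n r s = {x \<in> A. cyc_pos n r x < cyc_pos n r s}"
    using cyc_interval_iff[OF assms(1,2)] assms(3) by blast
  then show ?thesis by (simp add: rank_count_def)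
qed

text \<open>A change of starting point from \<open>r\<close> to \<open>s\<close> subtracts
  \<open>cyc_pos n r s\<close> from every position modulo \<open>n\<close>.\<close>

lemma cyc_pos_rebase:
  assumes "r \<in> {1..n}" "s \<in> {1..n}" "x \<in> {1..n}"
  shows "cyc_pos n s x = (if cyc_pos n r s \<le> cyc_pos n r x then cyc_pos n r x - cyc_pos n r s
                          else cyc_pos n r x + n - cyc_pos n r s)"
  using assms by (auto simp: cyc_pos_def)

text \<open>The first \<open>m\<close> elements for \<open>s\<close> occupy the positions
  \<open>d\<close>, ..., \<open>d + m - 1\<close> for \<open>r\<close>, read modulo
  \<open>n\<close>. Without wraparound they extend the first \<open>d\<close> elements to the first
  \<open>m + d\<close>. With wraparound the two sets cover \<open>A\<close> and overlap in its
  elements among the first \<open>m + d - n\<close>.\<close>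

lemma rank_count_rebase:
  assumes r: "r \<in> {1..n}" and s: "s \<in> {1..n}" and A: "A \<subseteq> {1..n}" and m: "m \<le> n"
  defines "d \<equiv> cyc_pos n r s"
  shows "rank_count n s A m + rank_count n r A d =
    (if m + d \<le> n then rank_count n r A (m + d) else card A + rank_count n r A (m + d - n))"
proof -
  have fin: "finite A" using A finite_subset by blast
  have d: "d < n" unfolding d_def using cyc_pos_less[OF r s] .
  have pos: "cyc_pos n s x = (if d \<le> cyc_pos n r x then cyc_pos n r x - d else cyc_pos n r x + n - d)"
    and lt: "cyc_pos n r x < n"
    if "x \<in> A" for x
    using cyc_pos_rebase[OF r s] cyc_pos_less[OF r] A that by (auto simp: d_def)
  let ?S = "{x \<in> A. cyc_pos n s x < m}" and ?D = "{x \<in> A. cyc_pos n r x < d}"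
  show ?thesis
  proof (cases "m + d \<le> n")
    case True
    have "?S \<union> ?D = {x \<in> A. cyc_pos n r x < m + d}" "?S \<inter> ?D = {}"
      using pos True d by (auto split: if_splits)
    then have "card ?S + card ?D = card {x \<in> A. cyc_pos n r x < m + d}"
      using card_Un_disjoint[of ?S ?D] fin by simp
    with True show ?thesis by (simp add: rank_count_def)
  next
    case False
    have "x \<in> ?S \<union> ?D" if "x \<in> A" for x
      using pos[OF that] lt[OF that] that False by (auto split: if_splits)
    then have "?S \<union> ?D = A" by blast
    moreover have "x \<in> ?S \<inter> ?D \<longleftrightarrow> cyc_pos n r x < m + d - n" if "x \<in> A" for x
      using pos[OF that] lt[OF that] that False m d by (auto split: if_splits)
    then have "?S \<inter> ?D = {x \<in> A. cyc_pos n r x < m + d - n}" by blast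
    ultimately have "card ?S + card ?D = card A + card {x \<in> A. cyc_pos n r x < m + d - n}"
      using card_Un_Int[of ?S ?D] fin by simp
    with False show ?thesis by (simp add: rank_count_def)
  qed
qed

text \<open>This settles the thresholds above \<open>n\<close>, which
  \<open>rank_count_rebase\<close> leaves out.\<close>

lemma rank_count_ge:
  assumes "r \<in> {1..n}" "A \<subseteq> {1..n}" "n \<le> m"
  shows "rank_count n r A m = card A"
proof -
  have "{x \<in> A. cyc_pos n r x < m} = A"
    using cyc_pos_less[OF assms(1)] assms(2,3) by fastforce
  then show ?thesis by (simp add: rank_count_def)
qed

text \<open>In \<open>rank_count_rebase\<close> the terms at \<open>d\<close> agree for
  \<open>A\<close> and \<open>B\<close> and cancel, as do the cardinalities, so each inequality for
  \<open>s\<close> reduces to one for \<open>r\<close>.\<close>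

lemma gale_le_rebase:
  assumes r: "r \<in> {1..n}" and s: "s \<in> {1..n}" and A: "A \<subseteq> {1..n}" and B: "B \<subseteq> {1..n}"
    and le: "gale_le n r A B"
    and eq: "card (A \<inter> cyc_interval n r s) = card (B \<inter> cyc_interval n r s)"
  shows "gale_le n s A B"
proof -
  have card: "card A = card B" and le': "\<And>m. rank_count n r B m \<le> rank_count n r A m"
    using le gale_le_iff_rank_count[OF r A B] by auto
  have eq': "rank_count n r A (cyc_pos n r s) = rank_count n r B (cyc_pos n r s)"
    using eq card_Int_cyc_interval[OF r s] A B by simp
  have "rank_count n s B m \<le> rank_count n s A m" for m
  proof (cases "m \<le> n")
    case True
    show ?thesis
      using rank_count_rebase[OF r s A True] rank_count_rebase[OF r s B True] card eq'
        le'[of "m + cyc_pos n r s"] le'[of "m + cyc_pos n r s - n"]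
      by (auto split: if_splits)
  next
    case False
    then show ?thesis using rank_count_ge[OF s A] rank_count_ge[OF s B] card by simp
  qed
  with card show ?thesis using gale_le_iff_rank_count[OF s A B] by blast
qed

section \<open>Prefixes and adjacent swaps\<close>

lemma prefix_set_subset: "w permutes {1..n} \<Longrightarrow> k \<le> n \<Longrightarrow> prefix_set w k \<subseteq> {1..n}"
  unfolding prefix_set_def using image_mono[of "{1..k}" "{1..n}" w] permutes_image[of w "{1..n}"]
  by simp

lemma prefix_set_Suc: "prefix_set w (Suc k) = insert (w (Suc k)) (prefix_set w k)"
  by (auto simp: prefix_set_def atLeastAtMostSuc_conv)

lemma card_prefix_set: "w permutes {1..n} \<Longrightarrow> card (prefix_set w k) = k"
  unfolding prefix_set_def
  by (subst card_image) (auto intro: inj_on_subset[OF permutes_inj])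

lemma rank_count_insert:
  assumes "finite A" "x \<notin> A"
  shows "rank_count n r (insert x A) m = rank_count n r A m + (if cyc_pos n r x < m then 1 else 0)"
proof -
  have "{y \<in> insert x A. cyc_pos n r y < m} =
    (if cyc_pos n r x < m then insert x {y \<in> A. cyc_pos n r y < m} else {y \<in> A. cyc_pos n r y < m})"
    by auto
  then show ?thesis using assms by (simp add: rank_count_def)
qed

lemma rank_count_prefix_set_Suc:
  assumes "w permutes {1..n}"
  shows "rank_count n r (prefix_set w (Suc k)) m =
    rank_count n r (prefix_set w k) m + (if cyc_pos n r (w (Suc k)) < m then 1 else 0)"
proof -
  have "w (Suc k) \<notin> prefix_set w k"
    by (auto simp: prefix_set_def inj_eq[OF permutes_inj[OF assms]])
  then show ?thesis unfolding prefix_set_Suc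
    by (intro rank_count_insert) (auto simp: prefix_set_def)
qed

lemma swap_right_permutes:
  assumes "w permutes {1..n}" "i \<in> {1..<n}"
  shows "swap_right w i permutes {1..n}"
  unfolding swap_right_def using assms by (intro permutes_compose permutes_swap_id) auto

text \<open>The transposition fixes \<open>{1..k}\<close> pointwise if \<open>k < i\<close>, and
  permutes it if \<open>k > i\<close>, since both swapped positions then lie inside.\<close>

lemma prefix_set_swap_right:
  assumes "k \<noteq> i" "1 \<le> i"
  shows "prefix_set (swap_right w i) k = prefix_set w k"
proof -
  have "Transposition.transpose i (i + 1) ` {1..k} = {1..k}"
  proof (cases "k < i")
    case True
    then have "Transposition.transpose i (i + 1) ` {1..k} = id ` {1..k}"
      by (intro image_cong) (auto simp: Transposition.transpose_def)
    then show ?thesis by simp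
  next
    case False
    with assms have "Transposition.transpose i (i + 1) permutes {1..k}"
      by (intro permutes_swap_id) auto
    then show ?thesis by (rule permutes_image)
  qed
  then show ?thesis
    unfolding prefix_set_def swap_right_def image_comp[symmetric] by simp
qed

lemma rank_count_prefix_set_swap_right:
  assumes "w permutes {1..n}" "i \<in> {1..<n}"
  shows "rank_count n r (prefix_set (swap_right w i) i) m =
    rank_count n r (prefix_set w (i - 1)) m + (if cyc_pos n r (w (Suc i)) < m then 1 else 0)"
proof -
  obtain j where j: "i = Suc j" using assms(2) by (cases i) auto
  have "swap_right w i i = w (Suc i)" by (simp add: swap_right_def)
  then show ?thesis
    using rank_count_prefix_set_Suc[OF swap_right_permutes[OF assms], of r j m]
      prefix_set_swap_right[of j i w] j by simp
qed

lemma cyc_interval_self: "cyc_interval n r r = {}"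
  by (simp add: cyc_interval_def)

section \<open>The lifting property\<close>

theorem theorem3p23:
  fixes n i :: nat and u v a :: "nat \<Rightarrow> nat"
  assumes "u permutes {1..n}"
    and "v permutes {1..n}"
    and "a \<in> {1..n} \<rightarrow> {1..n}"
    and "i \<in> {1..<n}"
    and "tilted_le n a u v"
    and "i \<in> Des n a v \<inter> Asc n a u"
  shows "tilted_le n a (swap_right u i) v \<and> tilted_le n a u (swap_right v i)"
proof -
  note u = assms(1) and v = assms(2) and i = assms(4)
  have gale: "gale_le n (a k) (prefix_set u k) (prefix_set v k)" if "k \<in> {1..n}" for k
    using assms(5) that by (simp add: tilted_le_def)
  have cnt: "card (prefix_set u k \<inter> cyc_interval n (a k) (a (k + 1))) =
      card (prefix_set v k \<inter> cyc_interval n (a k) (a (k + 1)))" if "k \<in> {1..<n}" for k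
    using assms(5) that by (simp add: tilted_le_def)
  have a: "a k \<in> {1..n}" if "k \<in> {1..n}" for k using assms(3) that by blast
  define r where "r = a i"
  have r: "r \<in> {1..n}" using a i by (simp add: r_def)
  have ar: "a (Suc i) = r"
    and uasc: "cyc_pos n r (u i) < cyc_pos n r (u (Suc i))"
    and vdes: "cyc_pos n r (v (Suc i)) < cyc_pos n r (v i)"
    using assms(6) by (auto simp: Des_def Asc_def r_def cyc_less_def)
  obtain j where j: "i = Suc j" using i by (cases i) auto
  have subs: "prefix_set u k \<subseteq> {1..n}" "prefix_set v k \<subseteq> {1..n}" if "k \<le> n" for k
    using that prefix_set_subset u v by auto
  have rank: "rank_count n r (prefix_set v k) m \<le> rank_count n r (prefix_set u k) m"
    if "k \<le> n" "gale_le n r (prefix_set u k) (prefix_set v k)" for k m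
    using gale_le_iff_rank_count[OF r subs[OF that(1)]] that(2) by blast
  \<comment> \<open>The hypothesis compares these prefixes for \<open>a j\<close>; the cardinality
    condition at \<open>j\<close> moves the comparison to \<open>r\<close>. For \<open>j = 0\<close>
    there is no such condition, but both prefixes are empty.\<close>
  have "gale_le n r (prefix_set u j) (prefix_set v j)"
  proof (cases "j = 0")
    case True
    then show ?thesis by (simp add: prefix_set_def gale_le_def)
  next
    case False
    with i j have "j \<in> {1..<n}" by auto
    then show ?thesis
      using gale_le_rebase[OF a r subs gale] cnt[of j] j by (auto simp: r_def)
  qed
  then have R0: "rank_count n r (prefix_set v j) m \<le> rank_count n r (prefix_set u j) m" for m
    using rank i j by simp
  have R1: "rank_count n r (prefix_set v i) m \<le> rank_count n r (prefix_set u i) m" for m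
    using rank[of i m] gale[of i] i by (simp add: r_def)
  have R2: "rank_count n r (prefix_set v (Suc i)) m \<le> rank_count n r (prefix_set u (Suc i)) m" for m
    using rank[of "Suc i" m] gale[of "Suc i"] i ar by simp
  note S = rank_count_prefix_set_Suc[OF u] rank_count_prefix_set_Suc[OF v]
  \<comment> \<open>Relative to length \<open>j\<close>, the left side gains 1 if \<open>v i\<close>
    is below the threshold, the right side if \<open>u (Suc i)\<close> is. \<open>R0\<close>
    suffices unless only \<open>v i\<close> is. Then \<open>v (Suc i)\<close> is below as well by
    the descent, so \<open>R2\<close> reads: rank of \<open>v\<close> plus 2 is at most rank of
    \<open>u\<close> plus 1, which supplies the missing unit.\<close>
  have usi: "rank_count n r (prefix_set v i) m \<le> rank_count n r (prefix_set (swap_right u i) i) m" for m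
    using R0[of m] R1[of m] R2[of m] uasc vdes rank_count_prefix_set_swap_right[OF u i, of r m] j
    by (auto simp: S split: if_splits)
  \<comment> \<open>Here the critical case has \<open>v (Suc i)\<close> below the threshold but not
    \<open>u i\<close>. By the ascent \<open>u (Suc i)\<close> is not below either, and
    \<open>R2\<close> again makes \<open>R0\<close> strict.\<close>
  have vsi: "rank_count n r (prefix_set (swap_right v i) i) m \<le> rank_count n r (prefix_set u i) m" for m
    using R0[of m] R1[of m] R2[of m] uasc vdes rank_count_prefix_set_swap_right[OF v i, of r m] j
    by (auto simp: S split: if_splits)
  note su = swap_right_permutes[OF u i] and sv = swap_right_permutes[OF v i]
  have in_le: "i \<le> n" using i by simp
  have gale_u: "gale_le n (a i) (prefix_set (swap_right u i) i) (prefix_set v i)"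
    using usi gale_le_iff_rank_count[OF r prefix_set_subset[OF su in_le] subs(2)[OF in_le]]
      card_prefix_set[OF su] card_prefix_set[OF v] by (simp add: r_def)
  have gale_v: "gale_le n (a i) (prefix_set u i) (prefix_set (swap_right v i) i)"
    using vsi gale_le_iff_rank_count[OF r subs(1)[OF in_le] prefix_set_subset[OF sv in_le]]
      card_prefix_set[OF sv] card_prefix_set[OF u] by (simp add: r_def)
  have other: "prefix_set (swap_right w i) k = prefix_set w k" if "k \<noteq> i" for w k
    using prefix_set_swap_right that i by simp
  \<comment> \<open>The swap changes only the prefix of length \<open>i\<close>, and there
    \<open>a i = a (i + 1)\<close> makes the cardinality condition trivial.\<close>
  have empty: "cyc_interval n (a i) (a (i + 1)) = {}"
    using ar cyc_interval_self by (simp add: r_def)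
  have "tilted_le n a (swap_right u i) v"
    unfolding tilted_le_def
  proof (intro conjI ballI)
    fix k assume "k \<in> {1..n}"
    then show "gale_le n (a k) (prefix_set (swap_right u i) k) (prefix_set v k)"
      using gale gale_u other by (cases "k = i") auto
  next
    fix k assume "k \<in> {1..<n}"
    then show "card (prefix_set (swap_right u i) k \<inter> cyc_interval n (a k) (a (k + 1))) =
      card (prefix_set v k \<inter> cyc_interval n (a k) (a (k + 1)))"
      using cnt other empty by (cases "k = i") auto
  qed
  moreover have "tilted_le n a u (swap_right v i)"
    unfolding tilted_le_def
  proof (intro conjI ballI)
    fix k assume "k \<in> {1..n}"
    then show "gale_le n (a k) (prefix_set u k) (prefix_set (swap_right v i) k)"
      using gale gale_v other by (cases "k = i") auto
  next
    fix k assume "k \<in> {1..<n}"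
    then show "card (prefix_set u k \<inter> cyc_interval n (a k) (a (k + 1))) =
      card (prefix_set (swap_right v i) k \<inter> cyc_interval n (a k) (a (k + 1)))"
      using cnt other empty by (cases "k = i") auto
  qed
  ultimately show ?thesis ..
qed

end
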